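(* Let $(a_1,\dots,a_{10})=(1,-5\beta^{2},\beta^{4},-5\beta^{6},-4\beta^{8},-5\beta^{10},\beta^{12},-5\beta^{14},\beta^{16},0)$. Then \[ \sum_{k=0}^\infty\frac{1}{\alpha^{20k}}\sum_{j=1}^{10}\frac{a_j}{10k+j}=0. \]
   Context: $\alpha=(1+\sqrt5)/2$ is the golden ratio and $\beta=-1/\alpha=(1-\sqrt5)/2$. *)

theory Defs
  imports Complex_Main
begin

definition golden_alpha :: real where
  "golden_alpha = (1 + sqrt 5) / 2"

definition golden_beta :: real where
  "golden_beta = - 1 / golden_alpha"

lemma golden_beta_eq: "golden_beta = (1 - sqrt 5) / 2"
proof -
  have "1 + sqrt 5 \<noteq> (0::real)"
    using real_sqrt_ge_zero[of 5] by linarith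
  then show ?thesis
    by (simp add: golden_beta_def golden_alpha_def field_simps)
qed

(* The coefficients are numbered from 1, list positions from 0; only the
   indices 1, ..., 10 are meaningful. *)
definition bbp_coeff :: "nat \<Rightarrow> real" where
  "bbp_coeff j =
     [1, - 5 * golden_beta ^ 2, golden_beta ^ 4, - 5 * golden_beta ^ 6,
      - 4 * golden_beta ^ 8, - 5 * golden_beta ^ 10, golden_beta ^ 12,
      - 5 * golden_beta ^ 14, golden_beta ^ 16, 0] ! (j - 1)"

end

theory Submission
  imports Defs "HOL-Analysis.Complex_Transcendental"
begin

text \<open>With \<open>x = \<beta>\<^sup>2\<close> we have \<open>a\<^sub>j = c\<^sub>j x\<^sup>j\<^sup>-\<^sup>1\<close>, where \<open>c\<^sub>j\<close> depends only on
  \<open>gcd(j, 10)\<close> and equals \<open>1 - 6[2 | j] - 5[5 | j] + 10[10 | j]\<close>. Each indicator \<open>[d | j]\<close>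
  picks out of the logarithm series the value \<open>-ln (1 - x\<^sup>d) / d\<close>, so \<open>x\<close> times the
  sum is \<open>-ln (1 - x) + 3 ln (1 - x\<^sup>2) + ln (1 - x\<^sup>5) - ln (1 - x\<^sup>1\<^sup>0)\<close>. This vanishes because
  \<open>(1 - x\<^sup>2)\<^sup>3 = (1 - x) (1 + x\<^sup>5)\<close>, a consequence of \<open>x\<^sup>2 = 3x - 1\<close>.\<close>

lemma ln_sums_blocks:
  fixes y :: real
  assumes "\<bar>y\<bar> < 1" "0 < m"
  shows "(\<lambda>k. \<Sum>i = 1..m. y ^ (m * k + i) / real (m * k + i)) sums - ln (1 - y)"
proof -
  have "(\<lambda>n. - (y ^ n / real n)) sums ln (1 - y)"
    using ln_series'[of "- y"] assms(1) by simp
  then have "(\<lambda>n. y ^ n / real n) sums - ln (1 - y)"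
    using sums_minus by fastforce
  \<comment> \<open>The term at \<open>n = 0\<close> is \<open>1 / 0 = 0\<close>, so dropping it
    leaves the sum unchanged.\<close>
  then have "(\<lambda>n. y ^ Suc n / real (Suc n)) sums - ln (1 - y)"
    by (subst sums_Suc_iff) simp
  from sums_group[OF this assms(2)]
  have "(\<lambda>k. \<Sum>n = k * m..<k * m + m. y ^ Suc n / real (Suc n)) sums - ln (1 - y)" .
  moreover have "(\<Sum>n = k * m..<k * m + m. y ^ Suc n / real (Suc n)) =
      (\<Sum>i = 1..m. y ^ (m * k + i) / real (m * k + i))" for k
    by (rule sum.reindex_bij_witness[of _ "\<lambda>i. m * k + i - 1" "\<lambda>n. Suc n - m * k"])
       (auto simp: mult.commute)
  ultimately show ?thesis by simp
qed

text \<open>Since \<open>(x ^ d) ^ n / n / d = x ^ (d * n) / (d * n)\<close>, the logarithm series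
  at \<open>x ^ d\<close> is the series at \<open>x\<close> restricted to multiples of
  \<open>d\<close>. Blocks of \<open>m\<close> terms become blocks of length \<open>d * m\<close>,
  so different \<open>d\<close> can share one block length.\<close>

lemma ln_sums_multiples_blocks:
  fixes x :: real
  assumes "\<bar>x\<bar> < 1" "0 < d" "0 < m"
  shows "(\<lambda>k. \<Sum>j = 1..d * m. of_bool (d dvd j) * (x ^ (d * m * k + j) / real (d * m * k + j)))
           sums (- ln (1 - x ^ d) / real d)"
proof -
  have "\<bar>x ^ d\<bar> < 1"
    using assms by (simp add: power_abs power_less_one_iff)
  from sums_divide[OF ln_sums_blocks[OF this assms(3)], of "real d"]
  have "(\<lambda>k. (\<Sum>i = 1..m. (x ^ d) ^ (m * k + i) / real (m * k + i)) / real d)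
      sums (- ln (1 - x ^ d) / real d)" .
  moreover have "(\<Sum>i = 1..m. (x ^ d) ^ (m * k + i) / real (m * k + i)) / real d =
      (\<Sum>j = 1..d * m. of_bool (d dvd j) * (x ^ (d * m * k + j) / real (d * m * k + j)))" for k
  proof -
    have "(\<Sum>i = 1..m. (x ^ d) ^ (m * k + i) / real (m * k + i)) / real d =
        (\<Sum>i = 1..m. x ^ (d * m * k + d * i) / real (d * m * k + d * i))"
      unfolding sum_divide_distrib
    proof (rule sum.cong[OF refl])
      fix i
      have "d * m * k + d * i = d * (m * k + i)"
        by (simp add: algebra_simps)
      then show "(x ^ d) ^ (m * k + i) / real (m * k + i) / real d =
          x ^ (d * m * k + d * i) / real (d * m * k + d * i)"
        by (simp only: power_mult of_nat_mult divide_divide_eq_left mult.commute)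
    qed
    also have "\<dots> = (\<Sum>j \<in> {j \<in> {1..d * m}. d dvd j}.
        x ^ (d * m * k + j) / real (d * m * k + j))"
      by (rule sum.reindex_bij_witness[of _ "\<lambda>j. j div d" "\<lambda>i. d * i"])
         (use assms in \<open>auto elim!: dvdE\<close>)
    also have "\<dots> = (\<Sum>j = 1..d * m.
        of_bool (d dvd j) * (x ^ (d * m * k + j) / real (d * m * k + j)))"
      by (rule sum.mono_neutral_cong_left) auto
    finally show ?thesis .
  qed
  ultimately show ?thesis by simp
qed

lemma golden_beta_square: "(golden_beta\<^sup>2)\<^sup>2 = 3 * golden_beta\<^sup>2 - 1"
  by (simp add: golden_beta_eq power2_eq_square field_simps)

lemma golden_beta_square_bounds: "0 < golden_beta\<^sup>2" "golden_beta\<^sup>2 < 1"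
proof -
  have "2 < sqrt (5::real)" "sqrt (5::real) < 3"
    by (simp_all add: real_less_rsqrt real_less_lsqrt)
  then have "- 1 < golden_beta" "golden_beta < 0"
    by (simp_all add: golden_beta_eq)
  then show "0 < golden_beta\<^sup>2" "golden_beta\<^sup>2 < 1"
    by (simp_all add: abs_square_less_1)
qed

text \<open>The factor \<open>golden_beta\<^sup>2\<close> raises the exponent from
  \<open>j - 1\<close> to \<open>j\<close>, as in the logarithm series. Writing the constant 1 as
  \<open>of_bool (1 dvd j)\<close> gives all four terms the same shape.\<close>

lemma bbp_coeff_altdef:
  assumes "j \<in> {1..10}"
  shows "golden_beta\<^sup>2 * bbp_coeff j = (golden_beta\<^sup>2) ^ j *
    (of_bool (1 dvd j) - 6 * of_bool (2 dvd j) - 5 * of_bool (5 dvd j) + 10 * of_bool (10 dvd j))"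
proof -
  have "j \<in> {1, 2, 3, 4, 5, 6, 7, 8, 9, 10}"
    using assms by (simp; presburger)
  then show ?thesis
    by (elim insertE emptyE; simp add: bbp_coeff_def flip: power_mult; algebra?)
qed

lemma golden_log_relation:
  defines "x \<equiv> golden_beta\<^sup>2"
  shows "ln (1 - x) + ln (1 - x ^ 10) = 3 * ln (1 - x\<^sup>2) + ln (1 - x ^ 5)"
proof -
  have x: "0 < x" "x < 1" and sq: "x\<^sup>2 = 3 * x - 1"
    using golden_beta_square golden_beta_square_bounds by (simp_all add: x_def)
  have lt: "x ^ n < 1" if "0 < n" for n
    using x that by (simp add: power_less_one_iff)
  \<comment> \<open>Powers of \<open>x\<close> reduce to linear polynomials modulo
    \<open>x\<^sup>2 = 3 * x - 1\<close>; here 55 and 21 are the Fibonacci numbers F_10 and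
    F_8.\<close>
  have x5: "x ^ 5 = 55 * x - 21"
    using sq by algebra
  \<comment> \<open>Both sides reduce to \<open>35 - 90 * x\<close>.\<close>
  have "(1 - x\<^sup>2) ^ 3 = (1 - x) * (1 + x ^ 5)"
    using sq unfolding x5 by algebra
  \<comment> \<open>Multiply by \<open>1 - x ^ 5\<close> and use
    \<open>(1 + x ^ 5) * (1 - x ^ 5) = 1 - x ^ 10\<close>.\<close>
  then have "(1 - x) * (1 - x ^ 10) = (1 - x\<^sup>2) ^ 3 * (1 - x ^ 5)"
    by algebra
  then have "ln ((1 - x) * (1 - x ^ 10)) = ln ((1 - x\<^sup>2) ^ 3 * (1 - x ^ 5))"
    by simp
  then show ?thesis
    using x lt[of 2] lt[of 5] lt[of 10] by (simp add: ln_mult ln_realpow)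
qed

theorem theorem5p7:
  shows "(\<lambda>k::nat. 1 / golden_alpha ^ (20 * k) *
            (\<Sum>j = 1..10. bbp_coeff j / real (10 * k + j))) sums 0"
proof -
  define x where "x = golden_beta\<^sup>2"
  have x: "0 < x" "x < 1"
    using golden_beta_square_bounds by (simp_all add: x_def)
  define S where "S d k = (\<Sum>j = 1..10. of_bool (d dvd j) *
    (x ^ (10 * k + j) / real (10 * k + j)))" for d k :: nat
  \<comment> \<open>Each block of ten indices contains \<open>m\<close> multiples of
    \<open>d\<close>, so the four series are aligned in \<open>k\<close> and can be combined
    termwise.\<close>
  have S: "S d sums (- ln (1 - x ^ d) / real d)" if "d * m = 10" for d m
    using ln_sums_multiples_blocks[of x d m] x that
    unfolding S_def by (cases "d = 0"; cases "m = 0") auto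
  have "(\<lambda>k. S 1 k - 6 * S 2 k - 5 * S 5 k + 10 * S 10 k) sums
      (- ln (1 - x ^ 1) / real 1 - 6 * (- ln (1 - x\<^sup>2) / real 2)
        - 5 * (- ln (1 - x ^ 5) / real 5) + 10 * (- ln (1 - x ^ 10) / real 10))"
    by (intro sums_add sums_diff sums_mult S[of 1 10] S[of 2 5] S[of 5 2] S[of 10 1]) simp_all
  also have "- ln (1 - x ^ 1) / real 1 - 6 * (- ln (1 - x\<^sup>2) / real 2)
        - 5 * (- ln (1 - x ^ 5) / real 5) + 10 * (- ln (1 - x ^ 10) / real 10) = 0"
    using golden_log_relation by (simp add: x_def)
  \<comment> \<open>Dividing by \<open>x\<close> undoes the extra factor in
    \<open>bbp_coeff_altdef\<close>.\<close>
  finally have "(\<lambda>k. (S 1 k - 6 * S 2 k - 5 * S 5 k + 10 * S 10 k) / x) sums (0 / x)"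
    by (rule sums_divide)
  moreover have "(S 1 k - 6 * S 2 k - 5 * S 5 k + 10 * S 10 k) / x =
      1 / golden_alpha ^ (20 * k) * (\<Sum>j = 1..10. bbp_coeff j / real (10 * k + j))" for k
  proof -
    \<comment> \<open>The exponent is even, so the sign in
      \<open>golden_beta = - 1 / golden_alpha\<close> disappears.\<close>
    have "1 / golden_alpha ^ (20 * k) = golden_beta ^ (20 * k)"
      by (simp add: golden_beta_def power_divide)
    then have alpha: "1 / golden_alpha ^ (20 * k) = x ^ (10 * k)"
      by (simp add: x_def flip: power_mult)
    have "S 1 k - 6 * S 2 k - 5 * S 5 k + 10 * S 10 k = (\<Sum>j = 1..10.
        (of_bool (1 dvd j) - 6 * of_bool (2 dvd j) - 5 * of_bool (5 dvd j) + 10 * of_bool (10 dvd j))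
          * (x ^ (10 * k + j) / real (10 * k + j)))"
      unfolding S_def by (simp only: sum_distrib_left left_diff_distrib distrib_right mult.assoc
        sum.distrib sum_subtractf)
    also have "\<dots> = (\<Sum>j = 1..10. x ^ (10 * k) * (x * bbp_coeff j) / real (10 * k + j))"
      by (rule sum.cong[OF refl])
         (simp only: bbp_coeff_altdef[folded x_def] power_add times_divide_eq_right times_divide_eq_left mult_ac)
    also have "\<dots> = x * (x ^ (10 * k) * (\<Sum>j = 1..10. bbp_coeff j / real (10 * k + j)))"
      by (simp add: sum_distrib_left mult_ac)
    finally show ?thesis
      using x(1) by (simp only: alpha) simp
  qed
  ultimately show ?thesis by simp
qed

end
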